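(* There cannot exist $\alpha$-approximate supply polyhedra (or convex sets) with $\alpha<\frac{\log D}{\log\log D}$ for all instances of $Q|f_i|C_{\min}$, where $D=D_{\max}/D_{\min}$ is the ratio of the largest to smallest demand of the instance.
   Context: An instance of $Q|f_i|C_{\min}$ has machines $i$ with demands $D_i>0$ and cardinality constraints $f_i\in\mathbb{Z}_{\ge1}$, and $n$ job types with capacities $c_j>0$. A supply vector $s\in\mathbb{Z}^n_{\ge0}$ is feasible if the multiset of $s_j$ jobs of capacity $c_j$ can be assigned (each job to at most one machine) so that machine $i$ receives at most $f_i$ jobs and total capacity at least $D_i$. A set $\mathcal{P}\subseteq\mathbb{R}^n$ (polyhedron or convex set) is an $\alpha$-approximate supply polyhedron for the instance if (a) every feasible supply vector lies in $\mathcal{P}$, and (b) for every non-negative integer vector $s\in\mathcal{P}$, the $s_j$ jobs of capacity $c_j$ can be assigned so that machine $i$ receives at most $f_i$ jobs and total capacity at least $D_i/\alpha$. *)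

theory Defs
  imports "HOL-Analysis.Analysis" "HOL-Analysis.Finite_Function_Topology"
begin

text \<open>
  Machines are the indices below \<open>machines I\<close> and job types the indices below
  \<open>job_types I\<close>; the functions are irrelevant outside these ranges.
\<close>

record qfc_instance =
  machines :: nat
  demand :: "nat \<Rightarrow> real"
  card_bound :: "nat \<Rightarrow> nat"
  job_types :: nat
  capacity :: "nat \<Rightarrow> real"

definition qfc_valid :: "qfc_instance \<Rightarrow> bool" where
  "qfc_valid I \<longleftrightarrow>
     0 < machines I \<and>
     (\<forall>i<machines I. 0 < demand I i \<and> 1 \<le> card_bound I i) \<and>
     (\<forall>j<job_types I. 0 < capacity I j)"

definition demand_ratio :: "qfc_instance \<Rightarrow> real" where
  "demand_ratio I =
     Max (demand I ` {..<machines I}) / Min (demand I ` {..<machines I})"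

text \<open>
  The number \<open>n\<close> of job types depends on the instance, so a vector of \<open>n\<close> numbers is
  a finitely supported function on \<^typ>\<open>nat\<close> whose support lies below \<open>n\<close>. On
  \<^typ>\<open>nat \<Rightarrow>\<^sub>0 real\<close> the library's real vector space structure is the pointwise one.
\<close>

definition vectors :: "nat \<Rightarrow> (nat \<Rightarrow>\<^sub>0 'a::zero) set" where
  "vectors n = {x. Poly_Mapping.keys x \<subseteq> {..<n}}"

text \<open>The pair \<open>(j, l)\<close> is the \<open>l\<close>-th of the available jobs of type \<open>j\<close>.\<close>

definition jobs :: "qfc_instance \<Rightarrow> (nat \<Rightarrow>\<^sub>0 nat) \<Rightarrow> (nat \<times> nat) set" where
  "jobs I s = (SIGMA j:{..<job_types I}. {..<Poly_Mapping.lookup s j})"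

text \<open>
  An assignment sends each job to at most one machine, \<open>None\<close> meaning that the job is
  not used; \<open>d\<close> gives the capacities that the machines have to receive.
\<close>

definition assignable :: "qfc_instance \<Rightarrow> (nat \<Rightarrow> real) \<Rightarrow> (nat \<Rightarrow>\<^sub>0 nat) \<Rightarrow> bool" where
  "assignable I d s \<longleftrightarrow>
     (\<exists>\<sigma> :: nat \<times> nat \<Rightarrow> nat option. \<forall>i<machines I.
        card {p \<in> jobs I s. \<sigma> p = Some i} \<le> card_bound I i \<and>
        d i \<le> (\<Sum>p | p \<in> jobs I s \<and> \<sigma> p = Some i. capacity I (fst p)))"

definition feasible_supply :: "qfc_instance \<Rightarrow> (nat \<Rightarrow>\<^sub>0 nat) \<Rightarrow> bool" where
  "feasible_supply I s \<longleftrightarrow> s \<in> vectors (job_types I) \<and> assignable I (demand I) s"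

abbreviation real_vector_of :: "(nat \<Rightarrow>\<^sub>0 nat) \<Rightarrow> (nat \<Rightarrow>\<^sub>0 real)" where
  "real_vector_of s \<equiv> Poly_Mapping.map real s"

text \<open>
  Positivity of \<open>\<alpha>\<close> is part of being an approximation factor: for \<open>\<alpha> \<le> 0\<close> the
  thresholds \<open>demand I i / \<alpha>\<close> would be met by empty machines.
\<close>

definition approx_supply_set :: "qfc_instance \<Rightarrow> real \<Rightarrow> (nat \<Rightarrow>\<^sub>0 real) set \<Rightarrow> bool" where
  "approx_supply_set I \<alpha> P \<longleftrightarrow>
     0 < \<alpha> \<and> P \<subseteq> vectors (job_types I) \<and>
     (\<forall>s. feasible_supply I s \<longrightarrow> real_vector_of s \<in> P) \<and>
     (\<forall>s. real_vector_of s \<in> P \<longrightarrow> assignable I (\<lambda>i. demand I i / \<alpha>) s)"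

end

theory Submission
  imports Defs "HOL-Real_Asymp.Real_Asymp"
begin

text \<open>
  There are \<open>K\<close> machines of demand \<open>D\<^sub>i = 2\<^sup>i\<close> and \<open>K - 1\<close> big jobs, each of which serves
  any machine alone. In the \<open>i\<close>-th supply the machine \<open>i\<close> is served instead by \<open>f\<^sub>i\<close> jobs
  of its own small type, of capacity \<open>D\<^sub>i / f\<^sub>i\<close>. The average of these \<open>K\<close> supplies has
  \<open>K - 1\<close> big jobs and only \<open>f\<^sub>i / K\<close> jobs of each small type \<open>i\<close>. Some machine \<open>i\<close> gets
  no big job; the types \<open>j \<le> i\<close> have total capacity at most
  \<open>\<Sum>\<^sub>j\<^sub>\<le>\<^sub>i D\<^sub>j / K \<le> 2 D\<^sub>i / K\<close>, and jobs of the types \<open>j > i\<close> are so small that \<open>f\<^sub>i\<close> of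
  them amount to at most \<open>D\<^sub>i / K\<close>. Hence \<open>\<alpha> \<ge> K / 3\<close>, while \<open>D = 2\<^sup>K\<^sup>-\<^sup>1\<close>.
\<close>

text \<open>For \<open>D = 2 ^ k\<close> the quotient \<open>ln D / ln (ln D)\<close> has order
  \<open>k / ln k\<close>, so it eventually drops below any positive multiple of
  \<open>k\<close>.\<close>

lemma ex_exponent_ln_ratio_le:
  fixes D :: real
  shows "\<exists>k. D \<le> 2 ^ k \<and> ln (2 ^ k) / ln (ln (2 ^ k)) \<le> real (Suc k) / 3"
proof -
  have "\<forall>\<^sub>F k in sequentially. D \<le> 2 ^ k"
    by real_asymp
  moreover have "\<forall>\<^sub>F k in sequentially. ln (2 ^ k) / ln (ln (2 ^ k)) \<le> real (Suc k) / 3"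
    by real_asymp
  ultimately have "\<forall>\<^sub>F k in sequentially.
      D \<le> 2 ^ k \<and> ln (2 ^ k) / ln (ln (2 ^ k)) \<le> real (Suc k) / 3"
    by (rule eventually_conj)
  then show ?thesis
    using eventually_happens'[OF sequentially_bot] by fast
qed

text \<open>Small capacities fall by a factor \<open>K\<close> from each type to the next. Type
  \<open>K\<close> is the big one; its capacity exceeds every demand.\<close>

definition gap_instance :: "nat \<Rightarrow> qfc_instance" where
  "gap_instance K =
     \<lparr>machines = K, demand = (\<lambda>i. 2 ^ i), card_bound = (\<lambda>i. 2 ^ i * K ^ Suc i),
      job_types = Suc K, capacity = (\<lambda>j. if j < K then 1 / real K ^ Suc j else 2 ^ K)\<rparr>"

definition gap_supply :: "nat \<Rightarrow> nat \<Rightarrow> (nat \<Rightarrow>\<^sub>0 nat)" where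
  "gap_supply K i = Poly_Mapping.single K (K - 1) + Poly_Mapping.single i (2 ^ i * K ^ Suc i)"

text \<open>The factor \<open>K ^ Suc j\<close> in the cardinality bounds keeps this average
  integral.\<close>

definition mean_supply :: "nat \<Rightarrow> (nat \<Rightarrow>\<^sub>0 nat)" where
  "mean_supply K = Poly_Mapping.single K (K - 1) + (\<Sum>j<K. Poly_Mapping.single j (2 ^ j * K ^ j))"

lemma gap_instance_simps [simp]:
  "machines (gap_instance K) = K"
  "demand (gap_instance K) i = 2 ^ i"
  "card_bound (gap_instance K) i = 2 ^ i * K ^ Suc i"
  "job_types (gap_instance K) = Suc K"
  "capacity (gap_instance K) j = (if j < K then 1 / real K ^ Suc j else 2 ^ K)"
  by (simp_all add: gap_instance_def)

lemma lookup_gap_supply: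
  assumes "i < K"
  shows "Poly_Mapping.lookup (gap_supply K i) j =
    (if j = K then K - 1 else if j = i then 2 ^ i * K ^ Suc i else 0)"
  using assms by (auto simp: gap_supply_def lookup_add lookup_single when_def)

lemma lookup_mean_supply:
  "Poly_Mapping.lookup (mean_supply K) j =
    (if j = K then K - 1 else if j < K then 2 ^ j * K ^ j else 0)"
proof -
  have "(\<Sum>i<K. Poly_Mapping.lookup (Poly_Mapping.single i (2 ^ i * K ^ i)) j) =
      (\<Sum>i<K. if i = j then 2 ^ j * K ^ j else 0)"
    by (intro sum.cong) (auto simp: lookup_single when_def)
  then show ?thesis
    by (auto simp: mean_supply_def lookup_add lookup_sum lookup_single when_def)
qed

lemma lookup_real_vector_of: "Poly_Mapping.lookup (real_vector_of s) j = real (Poly_Mapping.lookup s j)"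
  by (simp add: Poly_Mapping.map.rep_eq when_def)

lemma lookup_scaleR:
  "Poly_Mapping.lookup (r *\<^sub>R x) j = r *\<^sub>R Poly_Mapping.lookup (x :: 'a \<Rightarrow>\<^sub>0 'b::real_vector) j"
proof -
  have "finite {i. r *\<^sub>R Poly_Mapping.lookup x i \<noteq> 0}"
    by (rule finite_subset[OF _ finite_lookup[of x]]) auto
  then show ?thesis
    by (simp add: scaleR_poly_mapping_def)
qed

lemma gap_instance_valid: "0 < K \<Longrightarrow> qfc_valid (gap_instance K)"
  by (auto simp: qfc_valid_def Suc_le_eq)

lemma demand_ratio_gap_instance:
  assumes "0 < K"
  shows "demand_ratio (gap_instance K) = 2 ^ (K - 1)"
proof -
  have "Max (demand (gap_instance K) ` {..<K}) = 2 ^ (K - 1)"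
    using assms by (intro Max_eqI) (auto intro!: power_increasing image_eqI[of _ _ "K - 1"])
  moreover have "Min (demand (gap_instance K) ` {..<K}) = 1"
    using assms by (intro Min_eqI) (auto intro!: image_eqI[of _ _ 0])
  ultimately show ?thesis
    by (simp add: demand_ratio_def)
qed

lemma gap_supply_feasible:
  assumes i: "i < K"
  shows "feasible_supply (gap_instance K) (gap_supply K i)"
proof -
  let ?I = "gap_instance K" and ?s = "gap_supply K i"
  let ?f = "2 ^ i * K ^ Suc i"
  obtain k where k: "K = Suc k"
    using i by (cases K) auto
  \<comment> \<open>The big job \<open>i\<close> serves the machine \<open>K - 1\<close>, which would otherwise go without.\<close>
  define \<sigma> :: "nat \<times> nat \<Rightarrow> nat option" where
    "\<sigma> = (\<lambda>(j, l). Some (if j = K then if l = i then k else l else i))"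
  have jobs: "jobs ?I ?s = {K} \<times> {..<k} \<union> {i} \<times> {..<?f}"
    using i k unfolding jobs_def by (auto simp: lookup_gap_supply split: if_splits)
  have own: "{p \<in> jobs ?I ?s. \<sigma> p = Some i} = {i} \<times> {..<?f}"
    using i unfolding jobs \<sigma>_def by (auto split: if_splits)
  \<comment> \<open>The \<open>K - 1\<close> big jobs match the machines other than \<open>i\<close>
    one to one. For \<open>i = k\<close> no job is redirected, since every big index
    \<open>l\<close> is below \<open>k\<close>.\<close>
  have big: "{p \<in> jobs ?I ?s. \<sigma> p = Some m} = {(K, if m = k then i else m)}"
    if "m < K" "m \<noteq> i" for m
  proof -
    have "{p \<in> jobs ?I ?s. \<sigma> p = Some m} = {K} \<times> {l \<in> {..<k}. (if l = i then k else l) = m}"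
      using i that unfolding jobs \<sigma>_def by auto
    also have "{l \<in> {..<k}. (if l = i then k else l) = m} = {if m = k then i else m}"
      using i that k by auto
    finally show ?thesis
      by simp
  qed
  have "card {p \<in> jobs ?I ?s. \<sigma> p = Some m} \<le> card_bound ?I m \<and>
      demand ?I m \<le> (\<Sum>p | p \<in> jobs ?I ?s \<and> \<sigma> p = Some m. capacity ?I (fst p))"
    if m: "m < K" for m
  proof (cases "m = i")
    case True
    have "(\<Sum>p\<in>{i} \<times> {..<?f}. capacity ?I (fst p)) =
        (\<Sum>p\<in>{i} \<times> {..<?f}. 1 / real K ^ Suc i)"
      using i by (intro sum.cong) auto
    also have "\<dots> = 2 ^ i"
      using i by (simp add: card_cartesian_product)
    finally have "(\<Sum>p\<in>{i} \<times> {..<?f}. capacity ?I (fst p)) = 2 ^ i" .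
    with True show ?thesis
      unfolding True own by (simp add: card_cartesian_product)
  next
    case False
    show ?thesis
      unfolding big[OF m False] using m by (simp add: Suc_le_eq power_increasing)
  qed
  moreover have "?s \<in> vectors (job_types ?I)"
    using i by (auto simp: vectors_def in_keys_iff lookup_gap_supply split: if_splits)
  ultimately show ?thesis
    unfolding feasible_supply_def assignable_def by auto
qed

text \<open>All \<open>K\<close> supplies share the big jobs, while small type \<open>j\<close>
  occurs only in supply \<open>j\<close>, so averaging divides its count by
  \<open>K\<close>.\<close>

lemma mean_supply_eq_mean:
  assumes "0 < K"
  shows "real_vector_of (mean_supply K) =
    (\<Sum>i<K. (1 / real K) *\<^sub>R real_vector_of (gap_supply K i))"
proof (rule poly_mapping_eqI)
  fix j
  have "(\<Sum>i<K. real (Poly_Mapping.lookup (gap_supply K i) j) / real K) =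
      (\<Sum>i<K. if j = K then real (K - 1) / real K else if i = j then 2 ^ j * real K ^ j else 0)"
    using assms by (intro sum.cong) (auto simp: lookup_gap_supply)
  then show "Poly_Mapping.lookup (real_vector_of (mean_supply K)) j =
      Poly_Mapping.lookup (\<Sum>i<K. (1 / real K) *\<^sub>R real_vector_of (gap_supply K i)) j"
    using assms by (auto simp: lookup_sum lookup_scaleR lookup_real_vector_of lookup_mean_supply)
qed

text \<open>Convexity enters here: \<open>P\<close> contains the feasible gap supplies, hence their
  average.\<close>

lemma mean_supply_in_convex:
  assumes "0 < K" "convex P" "approx_supply_set (gap_instance K) \<alpha> P"
  shows "real_vector_of (mean_supply K) \<in> P"
  unfolding mean_supply_eq_mean[OF assms(1)] using assms gap_supply_feasible
  by (intro convex_sum) (auto simp: approx_supply_set_def)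

text \<open>Pigeonhole: \<open>K - 1\<close> big jobs cannot reach \<open>K\<close>
  machines.\<close>

lemma ex_machine_without_big_job:
  assumes "0 < (K::nat)"
  shows "\<exists>i<K. \<forall>l<K - 1. \<sigma> (K, l) \<noteq> Some i"
proof (rule ccontr)
  assume "\<not> ?thesis"
  then have "Some ` {..<K} \<subseteq> (\<lambda>l. \<sigma> (K, l)) ` {..<K - 1}"
    by force
  then have "card (Some ` {..<K}) \<le> card {..<K - 1}"
    by (meson card_image_le card_mono finite_imageI finite_lessThan le_trans)
  with assms show False
    by (simp add: card_image)
qed

lemma mean_supply_assignable_bound:
  assumes K: "0 < K" and \<alpha>: "0 < \<alpha>"
    and "assignable (gap_instance K) (\<lambda>i. 2 ^ i / \<alpha>) (mean_supply K)"
  shows "K / 3 \<le> \<alpha>"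
proof -
  let ?I = "gap_instance K" and ?s = "mean_supply K"
  let ?c = "\<lambda>p. capacity ?I (fst p)"
  obtain \<sigma> where \<sigma>: "\<And>i. i < K \<Longrightarrow> card {p \<in> jobs ?I ?s. \<sigma> p = Some i} \<le> 2 ^ i * K ^ Suc i"
      "\<And>i. i < K \<Longrightarrow> 2 ^ i / \<alpha> \<le> (\<Sum>p | p \<in> jobs ?I ?s \<and> \<sigma> p = Some i. ?c p)"
    using assms(3) by (auto simp: assignable_def)
  obtain i where i: "i < K" "\<And>l. l < K - 1 \<Longrightarrow> \<sigma> (K, l) \<noteq> Some i"
    using ex_machine_without_big_job[OF K] by blast
  define A where "A = {p \<in> jobs ?I ?s. \<sigma> p = Some i}"
  \<comment> \<open>\<open>B\<close> collects all supplied jobs of types up to \<open>i\<close>,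
    wherever assigned. Their total capacity is already small, so the cardinality bound is needed
    only for \<open>A - B\<close>.\<close>
  define B where "B = (SIGMA j:{..i}. {..<Poly_Mapping.lookup ?s j})"
  have fin: "finite A" "finite B"
    by (simp_all add: A_def B_def jobs_def)
  have small: "fst p < K" if "p \<in> A" for p
    using that i(2)[of "snd p"]
    by (cases p) (auto simp: A_def jobs_def lookup_mean_supply less_Suc_eq)
  have "sum ?c (A \<inter> B) \<le> sum ?c B"
    using fin by (intro sum_mono2) auto
  also have "sum ?c B = (\<Sum>j\<le>i. \<Sum>l<Poly_Mapping.lookup ?s j. capacity ?I j)"
    unfolding B_def by (subst sum.Sigma) (auto simp: split_def)
  also have "\<dots> = (\<Sum>j\<le>i. 2 ^ j / K)"
    using i(1) by (intro sum.cong) (auto simp: lookup_mean_supply)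
  also have "\<dots> = (2 ^ Suc i - 1) / K"
    using sum_gp_basic[of "2::real" i] by (simp add: sum_divide_distrib[symmetric])
  finally have AB: "sum ?c (A \<inter> B) \<le> 2 * 2 ^ i / K"
    using K by (simp add: divide_simps)
  \<comment> \<open>A small type \<open>j > i\<close> has capacity \<open>1 / K ^ Suc j\<close> with
    \<open>Suc j\<close> at least \<open>i + 2\<close>: one factor \<open>K\<close> beyond the one
    in the cardinality bound of machine \<open>i\<close>.\<close>
  have "?c p \<le> 1 / real K ^ (i + 2)" if "p \<in> A - B" for p
  proof -
    have "i < fst p" "fst p < K"
      using that small[of p] by (cases p; auto simp: A_def B_def jobs_def)+
    then show ?thesis
      using K power_increasing[of "i + 2" "Suc (fst p)" "real K"]
      by (simp add: frac_le del: power_Suc)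
  qed
  then have "sum ?c (A - B) \<le> card (A - B) * (1 / real K ^ (i + 2))"
    by (rule sum_bounded_above)
  also have "\<dots> \<le> real (2 ^ i * K ^ Suc i) * (1 / real K ^ (i + 2))"
  proof (rule mult_right_mono)
    have "card (A - B) \<le> card A"
      using fin by (intro card_mono) auto
    also have "\<dots> \<le> 2 ^ i * K ^ Suc i"
      using \<sigma>(1)[OF i(1)] by (simp add: A_def)
    finally show "real (card (A - B)) \<le> real (2 ^ i * K ^ Suc i)"
      by (rule of_nat_mono)
  qed simp
  also have "\<dots> = 2 ^ i / K"
    using K by (simp add: field_simps)
  finally have "sum ?c A \<le> 3 * 2 ^ i / K"
    using AB sum.Int_Diff[OF fin(1), of ?c B] by (simp add: field_simps)
  then have "2 ^ i / \<alpha> \<le> 3 * 2 ^ i / K"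
    using \<sigma>(2)[OF i(1)] unfolding A_def by linarith
  then show ?thesis
    using \<alpha> K by (simp add: field_simps)
qed

lemma approx_supply_set_gap_instance:
  assumes "0 < K" "convex P" "approx_supply_set (gap_instance K) \<alpha> P"
  shows "K / 3 \<le> \<alpha>"
  using mean_supply_in_convex[OF assms] assms mean_supply_assignable_bound[of K \<alpha>]
  by (auto simp: approx_supply_set_def)

theorem theorem15:
  fixes D\<^sub>0 :: real
  shows "\<not> (\<forall>I. qfc_valid I \<and> D\<^sub>0 \<le> demand_ratio I \<longrightarrow>
            (\<exists>\<alpha> P. \<alpha> < ln (demand_ratio I) / ln (ln (demand_ratio I)) \<and>
                   convex P \<and> approx_supply_set I \<alpha> P))"
proof -
  \<comment> \<open>With \<open>Suc k\<close> machines the demand ratio is \<open>2 ^ k\<close> and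
    \<alpha> is at least \<open>Suc k / 3\<close>; \<open>k\<close> is large enough for this to
    reach the claimed threshold.\<close>
  obtain k where k: "D\<^sub>0 \<le> 2 ^ k" "ln (2 ^ k) / ln (ln (2 ^ k)) \<le> real (Suc k) / 3"
    using ex_exponent_ln_ratio_le by blast
  let ?I = "gap_instance (Suc k)"
  have I: "qfc_valid ?I" "demand_ratio ?I = 2 ^ k"
    using gap_instance_valid[of "Suc k"] demand_ratio_gap_instance[of "Suc k"] by simp_all
  have "ln (2 ^ k) / ln (ln (2 ^ k)) \<le> \<alpha>" if "convex P" "approx_supply_set ?I \<alpha> P" for \<alpha> P
    using k(2) approx_supply_set_gap_instance[OF zero_less_Suc that] by (rule order_trans)
  then have "\<nexists>\<alpha> P. \<alpha> < ln (demand_ratio ?I) / ln (ln (demand_ratio ?I)) \<and>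
      convex P \<and> approx_supply_set ?I \<alpha> P"
    unfolding I(2) by (meson leD)
  moreover have "qfc_valid ?I \<and> D\<^sub>0 \<le> demand_ratio ?I"
    using I k(1) by simp
  ultimately show ?thesis
    by blast
qed

end
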